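(* Let $\mathcal{M}=\langle Q,A,\delta\rangle$ be an MDP with $n=|Q|$ states, let $\alpha$ be the smallest positive probability in the transitions of $\mathcal{M}$, let $T\subseteq Q$, let $d_0$ be an initial distribution with smallest positive probability $\alpha_0$, and let $\epsilon_a=\alpha_0\cdot\frac{\alpha^{n}}{n}$ and $\epsilon_s=\alpha_0\cdot\frac{\alpha^{2n}}{n^2}$. Then: (i) if $d_0$ is not sure always synchronizing in $T$ (there is no strategy $\sigma$ with $\mathcal{M}^{\sigma}_i(T)=1$ for all $i\ge0$), then for every strategy $\sigma$ there is a position $i\le n$ with $\mathcal{M}^{\sigma}_i(T)<1-\epsilon_a$; (ii) if $d_0$ is not sure strongly synchronizing in $T$ (there is no strategy $\sigma$ and $N$ with $\mathcal{M}^{\sigma}_i(T)=1$ for all $i\ge N$), then for every strategy $\sigma$ there exist infinitely many positions $i_0<i_1<i_2<\cdots$ with $i_0\le n$ and $i_{j+1}-i_j\le n$ for all $j\ge0$, such that $\mathcal{M}^{\sigma}_{i_j}(T)<1$ for all $j$; (iii) if $d_0$ is not almost-sure strongly synchronizing in $T$ (there is no strategy $\sigma$ such that for every $\epsilon>0$ there is $N$ with $\mathcal{M}^{\sigma}_i(T)\ge1-\epsilon$ for all $i\ge N$), then for every strategy $\sigma$ there exist infinitely many positions $i_0<i_1<i_2<\cdots$ with $i_0\le n$ and $i_{j+1}-i_j\le n$ for all $j\ge0$, such that $\mathcal{M}^{\sigma}_{i_j}(T)<1-\epsilon_s$ for all $j$.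
   Context: An MDP is $\mathcal{M}=\langle Q,A,\delta\rangle$ with $Q$ finite set of states, $A$ finite set of actions, $\delta:Q\times A\to\mathcal{D}(Q)$ probabilistic transition function. A (randomized) strategy is a function $\sigma:(QA)^*Q\to\mathcal{D}(A)$; with initial distribution $d_0$ it induces a probability measure $\Pr^{\sigma}_{d_0}$ on infinite paths in the standard way. $\mathcal{M}^{\sigma}_i(q)=\Pr^{\sigma}_{d_0}(\text{the state at position } i \text{ is } q)$ is the distribution after $i$ steps, $d(T)=\sum_{q\in T}d(q)$, and the smallest positive probability of $d_0$ is $\min\{d_0(q)\mid d_0(q)>0\}$. A distribution $d$ is $p$-synchronized in $T$ if $d(T)\ge p$; "not $p$-synchronized" thus means $d(T)<p$.
   Formalization: Parts (i) and (iii) are stated except when n = 1 and T is empty; there α = α₀ = ε_a = ε_s = 1, d_0 is not synchronizing in T, and the claimed strict bound reads 0 < 0, so the claim as written is false. *)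

theory Defs
  imports "HOL-Probability.Probability"
begin

text \<open>
  An MDP over the finite types of states and actions is given by its transition function
  \<open>\<delta> :: 'q \<Rightarrow> 'a \<Rightarrow> 'q pmf\<close>. A history in \<open>(QA)\<^sup>*Q\<close> is a list of state-action pairs together with
  the current state.
\<close>

type_synonym ('q, 'a) mdp = "'q \<Rightarrow> 'a \<Rightarrow> 'q pmf"
type_synonym ('q, 'a) strategy = "('q \<times> 'a) list \<Rightarrow> 'q \<Rightarrow> 'a pmf"

text \<open>
  An infinite path \<open>q\<^sub>0 a\<^sub>0 q\<^sub>1 a\<^sub>1 \<dots>\<close> is a function \<open>\<omega> :: nat \<Rightarrow> 'q \<times> 'a\<close>. The kernel below gives
  the distribution of \<open>(q\<^sub>i, a\<^sub>i)\<close> conditional on the first \<open>i\<close> pairs; the measure on paths is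
  the projective limit provided by the Ionescu-Tulcea theorem, see \<open>Ionescu_Tulcea_step\<close>
  and \<open>emeasure_path_cylinder\<close>.
\<close>

definition step ::
    "('q, 'a) mdp \<Rightarrow> ('q, 'a) strategy \<Rightarrow> 'q pmf \<Rightarrow> nat \<Rightarrow> (nat \<Rightarrow> 'q \<times> 'a) \<Rightarrow> ('q \<times> 'a) pmf" where
  "step \<delta> \<sigma> d0 i \<omega> =
     (case i of 0 \<Rightarrow> d0 | Suc k \<Rightarrow> case_prod \<delta> (\<omega> k)) \<bind>
       (\<lambda>q. map_pmf (Pair q) (\<sigma> (map \<omega> [0..<i]) q))"

definition path_measure ::
    "('q, 'a) mdp \<Rightarrow> ('q, 'a) strategy \<Rightarrow> 'q pmf \<Rightarrow> (nat \<Rightarrow> 'q \<times> 'a) measure" where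
  "path_measure \<delta> \<sigma> d0 =
     projective_family.lim UNIV
       (Ionescu_Tulcea.CI (\<lambda>i \<omega>. measure_pmf (step \<delta> \<sigma> d0 i \<omega>)) (\<lambda>_. count_space UNIV))
       (\<lambda>_. count_space UNIV)"

definition state_dist ::
    "('q, 'a) mdp \<Rightarrow> ('q, 'a) strategy \<Rightarrow> 'q pmf \<Rightarrow> nat \<Rightarrow> 'q \<Rightarrow> real" where
  "state_dist \<delta> \<sigma> d0 i q = measure (path_measure \<delta> \<sigma> d0) {\<omega>. fst (\<omega> i) = q}"

definition mass :: "('q \<Rightarrow> real) \<Rightarrow> 'q set \<Rightarrow> real" where
  "mass d T = (\<Sum>q\<in>T. d q)"

definition sure_always_sync :: "('q, 'a) mdp \<Rightarrow> 'q pmf \<Rightarrow> 'q set \<Rightarrow> bool" where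
  "sure_always_sync \<delta> d0 T \<longleftrightarrow> (\<exists>\<sigma>. \<forall>i. mass (state_dist \<delta> \<sigma> d0 i) T = 1)"

definition sure_strongly_sync :: "('q, 'a) mdp \<Rightarrow> 'q pmf \<Rightarrow> 'q set \<Rightarrow> bool" where
  "sure_strongly_sync \<delta> d0 T \<longleftrightarrow> (\<exists>\<sigma> N. \<forall>i\<ge>N. mass (state_dist \<delta> \<sigma> d0 i) T = 1)"

definition almost_sure_strongly_sync :: "('q, 'a) mdp \<Rightarrow> 'q pmf \<Rightarrow> 'q set \<Rightarrow> bool" where
  "almost_sure_strongly_sync \<delta> d0 T \<longleftrightarrow>
     (\<exists>\<sigma>. \<forall>\<epsilon>>0. \<exists>N. \<forall>i\<ge>N. mass (state_dist \<delta> \<sigma> d0 i) T \<ge> 1 - \<epsilon>)"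

definition min_init_prob :: "'q pmf \<Rightarrow> real" where
  "min_init_prob d0 = Min {pmf d0 q | q. pmf d0 q > 0}"

definition min_trans_prob :: "('q, 'a) mdp \<Rightarrow> real" where
  "min_trans_prob \<delta> = Min {pmf (\<delta> q a) q' | q a q'. pmf (\<delta> q a) q' > 0}"


lemma step_cong:
  assumes "\<And>k. k < i \<Longrightarrow> \<omega> k = \<omega>' k"
  shows "step \<delta> \<sigma> d0 i \<omega> = step \<delta> \<sigma> d0 i \<omega>'"
proof -
  have hist: "map \<omega> [0..<i] = map \<omega>' [0..<i]" using assms by simp
  show ?thesis unfolding step_def hist using assms by (cases i) (simp_all del: upt_Suc)
qed

lemma Ionescu_Tulcea_step:
  fixes \<delta> :: "('q::finite, 'a::finite) mdp"
  shows "Ionescu_Tulcea (\<lambda>i \<omega>. measure_pmf (step \<delta> \<sigma> d0 i \<omega>)) (\<lambda>_. count_space UNIV)"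
proof (unfold_locales, goal_cases)
  case (1 i)
  have "PiM {0..<i} (\<lambda>_. count_space (UNIV :: ('q \<times> 'a) set)) =
      count_space (PiE {0..<i} (\<lambda>_. UNIV))"
    by (rule count_space_PiM_finite) auto
  then show ?case
    by (simp add: space_subprob_algebra prob_space_imp_subprob_space prob_space_measure_pmf)
qed

lemma emeasure_path_cylinder:
  fixes \<delta> :: "('q::finite, 'a::finite) mdp"
  shows "emeasure (path_measure \<delta> \<sigma> d0) {\<omega>. \<forall>i<n. \<omega> i = x i} =
    ennreal (\<Prod>i<n. pmf (step \<delta> \<sigma> d0 i x) (x i))"
proof -
  let ?M = "\<lambda>_::nat. count_space (UNIV :: ('q \<times> 'a) set)"
  interpret IT: Ionescu_Tulcea "\<lambda>i \<omega>. measure_pmf (step \<delta> \<sigma> d0 i \<omega>)" ?M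
    by (rule Ionescu_Tulcea_step)
  have PiM_eq: "PiM {0..<k} ?M = count_space (PiE {0..<k} (\<lambda>_. UNIV))" for k
    by (rule count_space_PiM_finite) auto
  have sing: "{restrict x {0..<k}} \<in> sets (PiM {0..<k} ?M)" for k
    unfolding PiM_eq by auto
  have C: "emeasure (IT.C 0 k (\<lambda>_. undefined)) {restrict x {0..<k}} =
      ennreal (\<Prod>i<k. pmf (step \<delta> \<sigma> d0 i x) (x i))" for k
  proof (induction k)
    case 0
    show ?case
      using emeasure_return[OF sing[of 0], of "\<lambda>_. undefined"]
      by (simp add: restrict_def indicator_def)
  next
    case (Suc k)
    let ?C = "IT.C 0 k (\<lambda>_. undefined)"
    have u: "(\<lambda>_. undefined) \<in> space (PiM {0..<0} ?M)" by (simp add: space_PiM)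
    have sp: "space ?C = space (PiM {0..<k} ?M)" using IT.space_C[OF u, of k] by simp
    have st: "sets ?C = sets (PiM {0..<k} ?M)" using IT.sets_C[OF u, of k] by simp
    have eP: "emeasure (IT.eP k \<omega>) {restrict x {0..<Suc k}} =
        ennreal (pmf (step \<delta> \<sigma> d0 k x) (x k)) * indicator {restrict x {0..<k}} \<omega>"
      if \<omega>: "\<omega> \<in> space (PiM {0..<k} ?M)" for \<omega>
    proof -
      have ext: "\<omega> \<in> extensional {0..<k}" using \<omega> by (auto simp: space_PiM PiE_iff)
      have iff: "fun_upd \<omega> k y = restrict x {0..<Suc k} \<longleftrightarrow> \<omega> = restrict x {0..<k} \<and> y = x k" for y
      proof
        assume *: "fun_upd \<omega> k y = restrict x {0..<Suc k}"
        have "\<omega> j = restrict x {0..<k} j" for j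
          using fun_cong[OF *, of j] ext
          by (cases "j = k") (auto simp: extensional_def split: if_splits)
        moreover have "y = x k" using fun_cong[OF *, of k] by simp
        ultimately show "\<omega> = restrict x {0..<k} \<and> y = x k" by auto
      qed (auto simp: fun_eq_iff)
      have "emeasure (IT.eP k \<omega>) {restrict x {0..<Suc k}} =
          emeasure (measure_pmf (step \<delta> \<sigma> d0 k \<omega>)) {y. fun_upd \<omega> k y = restrict x {0..<Suc k}}"
        by (subst IT.emeasure_eP[OF \<omega> sing]) (auto intro!: arg_cong2[where f=emeasure])
      also have "\<dots> = ennreal (pmf (step \<delta> \<sigma> d0 k x) (x k)) * indicator {restrict x {0..<k}} \<omega>"
      proof (cases "\<omega> = restrict x {0..<k}")
        case True
        have "step \<delta> \<sigma> d0 k \<omega> = step \<delta> \<sigma> d0 k x" by (rule step_cong) (simp add: True)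
        then show ?thesis unfolding iff using True by (simp add: emeasure_pmf_single)
      qed (simp add: iff)
      finally show ?thesis .
    qed
    have meas: "IT.eP k \<in> ?C \<rightarrow>\<^sub>M subprob_algebra (PiM {0..<Suc k} ?M)"
      using IT.measurable_eP[of k] measurable_cong_sets[OF st refl] by blast
    have "emeasure (IT.C 0 (Suc k) (\<lambda>_. undefined)) {restrict x {0..<Suc k}} =
        (\<integral>\<^sup>+\<omega>. emeasure (IT.eP k \<omega>) {restrict x {0..<Suc k}} \<partial>?C)"
      using emeasure_bind[OF _ meas sing] by (simp add: sp)
    also have "\<dots> = (\<integral>\<^sup>+\<omega>. ennreal (pmf (step \<delta> \<sigma> d0 k x) (x k)) *
        indicator {restrict x {0..<k}} \<omega> \<partial>?C)"
      by (intro nn_integral_cong eP) (simp add: sp)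
    also have "\<dots> = ennreal (pmf (step \<delta> \<sigma> d0 k x) (x k)) * emeasure ?C {restrict x {0..<k}}"
      by (rule nn_integral_cmult_indicator) (simp only: st sing)
    also have "\<dots> = ennreal (\<Prod>i<Suc k. pmf (step \<delta> \<sigma> d0 i x) (x i))"
      unfolding Suc by (simp add: ennreal_mult'' mult.commute prod_nonneg)
    finally show ?case .
  qed
  have eq: "{\<omega>. \<forall>i<n. \<omega> i = x i} = prod_emb UNIV ?M {0..<n} {restrict x {0..<n}}"
    by (auto simp: prod_emb_def fun_eq_iff restrict_def; metis)
  have emb: "prod_emb {0..<n} ?M {0..<n} {restrict x {0..<n}} = {restrict x {0..<n}}"
    by (rule prod_emb_id) auto
  show ?thesis
    unfolding path_measure_def eq
    using IT.lim[OF _ sing] IT.emeasure_CI[OF subset_refl sing] emb C by simp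
qed

end

theory Submission
  imports Defs
begin

text \<open>
  Let \<open>S\<close> be the largest subset of \<open>T\<close> in which one can surely stay. A state outside \<open>S\<close> leaves \<open>T\<close>
  with probability at least \<open>\<alpha>\<^sup>n\<^sup>-\<^sup>1\<close> within \<open>n - 1\<close> steps whatever the strategy, so a mass \<open>p\<close>
  outside \<open>S\<close> at position \<open>m\<close> forces a mass at least \<open>p \<alpha>\<^sup>n\<^sup>-\<^sup>1 / n\<close> outside \<open>T\<close> at one of the
  positions \<open>m, \<dots>, m + n - 1\<close>. For sure synchronization the mass outside \<open>S\<close> is nonzero because
  otherwise one could switch to a safe strategy. For almost-sure synchronization, \<open>d0\<close> charges a
  state from which \<open>S\<close> cannot be reached almost surely; the attractor computation yields a
  submartingale that bounds the mass outside \<open>S\<close> at every position from below by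
  \<open>\<alpha>0 \<alpha>\<^sup>n\<^sup>-\<^sup>1\<close>. The strictness of the bounds comes from the slack between \<open>\<alpha>\<^sup>n\<^sup>-\<^sup>1\<close>, \<open>\<alpha>\<^sup>n\<close> and
  the factors \<open>1 / n\<close>, with the initial position treated separately in the first claim.
\<close>

subsection \<open>State distributions as probability mass functions\<close>

text \<open>Discrete counterpart of \<open>path_measure\<close>, open to induction on the length.
  Passing \<open>nth h\<close> as the path is harmless, since \<open>step\<close> at position
  \<open>n\<close> reads only positions below \<open>n\<close>.\<close>

primrec hist_pmf ::
    "('q, 'a) mdp \<Rightarrow> ('q, 'a) strategy \<Rightarrow> 'q pmf \<Rightarrow> nat \<Rightarrow> ('q \<times> 'a) list pmf" where
  "hist_pmf \<delta> \<sigma> d0 0 = return_pmf []"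
| "hist_pmf \<delta> \<sigma> d0 (Suc n) =
     hist_pmf \<delta> \<sigma> d0 n \<bind> (\<lambda>h. map_pmf (\<lambda>p. h @ [p]) (step \<delta> \<sigma> d0 n (nth h)))"

text \<open>This marginal alone determines the law of the next state, although the strategy depends
  on the whole history.\<close>

definition occ_pmf ::
    "('q, 'a) mdp \<Rightarrow> ('q, 'a) strategy \<Rightarrow> 'q pmf \<Rightarrow> nat \<Rightarrow> ('q \<times> 'a) pmf" where
  "occ_pmf \<delta> \<sigma> d0 n = hist_pmf \<delta> \<sigma> d0 n \<bind> (\<lambda>h. step \<delta> \<sigma> d0 n (nth h))"

definition state_pmf ::
    "('q, 'a) mdp \<Rightarrow> ('q, 'a) strategy \<Rightarrow> 'q pmf \<Rightarrow> nat \<Rightarrow> 'q pmf" where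
  "state_pmf \<delta> \<sigma> d0 n = map_pmf fst (occ_pmf \<delta> \<sigma> d0 n)"

lemma length_hist_pmf: "h \<in> set_pmf (hist_pmf \<delta> \<sigma> d0 n) \<Longrightarrow> length h = n"
  by (induction n arbitrary: h) auto

text \<open>The product is the one in \<open>emeasure_path_cylinder\<close>, which ties the discrete
  model to the path measure.\<close>

lemma pmf_hist_pmf:
  "pmf (hist_pmf \<delta> \<sigma> d0 n) (map x [0..<n]) = (\<Prod>i<n. pmf (step \<delta> \<sigma> d0 i x) (x i))"
proof (induction n)
  case 0
  show ?case by simp
next
  case (Suc n)
  let ?h = "map x [0..<n]"
  have st: "step \<delta> \<sigma> d0 n (nth ?h) = step \<delta> \<sigma> d0 n x"
    by (rule step_cong) simp
  have "pmf (map_pmf (\<lambda>p. h @ [p]) (step \<delta> \<sigma> d0 n (nth h))) (map x [0..<Suc n]) =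
      indicator {?h} h * pmf (step \<delta> \<sigma> d0 n x) (x n)" for h
  proof (cases "h = ?h")
    case True
    have inj: "inj (\<lambda>p. ?h @ [p])" by (simp add: inj_def)
    show ?thesis using pmf_map_inj'[OF inj, of "step \<delta> \<sigma> d0 n (nth ?h)" "x n"] True st by simp
  next
    case False
    then have "map x [0..<Suc n] \<notin> set_pmf (map_pmf (\<lambda>p. h @ [p]) (step \<delta> \<sigma> d0 n (nth h)))"
      by auto
    then have "pmf (map_pmf (\<lambda>p. h @ [p]) (step \<delta> \<sigma> d0 n (nth h))) (map x [0..<Suc n]) = 0"
      unfolding set_pmf_iff by (simp only: not_not)
    then show ?thesis using False by simp
  qed
  then have "pmf (hist_pmf \<delta> \<sigma> d0 (Suc n)) (map x [0..<Suc n]) =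
      pmf (hist_pmf \<delta> \<sigma> d0 n) ?h * pmf (step \<delta> \<sigma> d0 n x) (x n)"
    by (simp only: hist_pmf.simps pmf_bind) (simp add: measure_pmf_single)
  then show ?case using Suc by simp
qed

text \<open>Both measures live on a countable type, so singletons suffice; their preimages are
  cylinders or empty.\<close>

lemma distr_path_measure:
  fixes \<delta> :: "('q::finite, 'a::finite) mdp"
  shows "(\<lambda>\<omega>. map \<omega> [0..<n]) \<in> measurable (path_measure \<delta> \<sigma> d0) (count_space UNIV)"
    and "distr (path_measure \<delta> \<sigma> d0) (count_space UNIV) (\<lambda>\<omega>. map \<omega> [0..<n]) =
      measure_pmf (hist_pmf \<delta> \<sigma> d0 n)"
proof -
  let ?M = "\<lambda>_::nat. count_space (UNIV :: ('q \<times> 'a) set)"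
  let ?P = "path_measure \<delta> \<sigma> d0"
  interpret IT: Ionescu_Tulcea "\<lambda>i \<omega>. measure_pmf (step \<delta> \<sigma> d0 i \<omega>)" ?M
    by (rule Ionescu_Tulcea_step)
  have sets_P: "sets ?P = sets (PiM UNIV ?M)" and space_P: "space ?P = UNIV"
    unfolding path_measure_def by (simp_all add: space_PiM)
  have pre: "(\<lambda>\<omega>. map \<omega> [0..<n]) -` {xs} =
      (if length xs = n then {\<omega>. \<forall>i<n. \<omega> i = xs ! i} else {})" for xs :: "('q \<times> 'a) list"
    unfolding vimage_def by (simp add: list_eq_iff_nth_eq)
  have cyl: "{\<omega>. \<forall>i<n. \<omega> i = x i} \<in> sets ?P" for x :: "nat \<Rightarrow> 'q \<times> 'a"
  proof -
    have "{\<omega> \<in> space (PiM UNIV ?M). \<forall>i<n. \<omega> i = x i} \<in> sets (PiM UNIV ?M)"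
      by measurable
    then show ?thesis by (simp add: sets_P space_PiM)
  qed
  show meas: "(\<lambda>\<omega>. map \<omega> [0..<n]) \<in> measurable ?P (count_space UNIV)"
    by (subst measurable_count_space_eq2_countable) (auto simp: pre space_P cyl)
  show "distr ?P (count_space UNIV) (\<lambda>\<omega>. map \<omega> [0..<n]) = measure_pmf (hist_pmf \<delta> \<sigma> d0 n)"
  proof (rule measure_eqI_countable[where A = UNIV])
    fix xs :: "('q \<times> 'a) list"
    have e: "emeasure (distr ?P (count_space UNIV) (\<lambda>\<omega>. map \<omega> [0..<n])) {xs} =
        emeasure ?P (if length xs = n then {\<omega>. \<forall>i<n. \<omega> i = xs ! i} else {})"
      by (subst emeasure_distr[OF meas]) (simp_all only: pre space_P Int_UNIV_right, simp)
    show "emeasure (distr ?P (count_space UNIV) (\<lambda>\<omega>. map \<omega> [0..<n])) {xs} =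
        emeasure (measure_pmf (hist_pmf \<delta> \<sigma> d0 n)) {xs}"
    proof (cases "length xs = n")
      case True
      have "map (nth xs) [0..<n] = xs" using True map_nth by blast
      then show ?thesis unfolding e
        using True pmf_hist_pmf[of \<delta> \<sigma> d0 n "nth xs"]
        by (simp add: emeasure_path_cylinder emeasure_pmf_single)
    next
      case False
      then have "xs \<notin> set_pmf (hist_pmf \<delta> \<sigma> d0 n)" using length_hist_pmf by blast
      then show ?thesis unfolding e using False by (simp add: emeasure_pmf_single set_pmf_iff)
    qed
  qed auto
qed

lemma state_dist_eq_pmf:
  fixes \<delta> :: "('q::finite, 'a::finite) mdp"
  shows "state_dist \<delta> \<sigma> d0 i q = pmf (state_pmf \<delta> \<sigma> d0 i) q"
proof -
  let ?P = "path_measure \<delta> \<sigma> d0"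
  let ?f = "\<lambda>\<omega> :: nat \<Rightarrow> 'q \<times> 'a. map \<omega> [0..<Suc i]"
  interpret IT: Ionescu_Tulcea "\<lambda>i \<omega>. measure_pmf (step \<delta> \<sigma> d0 i \<omega>)"
      "\<lambda>_::nat. count_space (UNIV :: ('q \<times> 'a) set)"
    by (rule Ionescu_Tulcea_step)
  have space_P: "space ?P = UNIV" unfolding path_measure_def by (simp add: space_PiM)
  have "state_dist \<delta> \<sigma> d0 i q = measure ?P (?f -` {h. fst (last h) = q} \<inter> space ?P)"
    unfolding state_dist_def by (rule arg_cong2[where f = measure]) (auto simp: space_P)
  also have "\<dots> = measure (hist_pmf \<delta> \<sigma> d0 (Suc i)) {h. fst (last h) = q}"
    unfolding distr_path_measure(2)[symmetric]
    by (rule measure_distr[symmetric]) (auto intro: distr_path_measure(1) simp del: upt_Suc)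
  also have "\<dots> = pmf (map_pmf (\<lambda>h. fst (last h)) (hist_pmf \<delta> \<sigma> d0 (Suc i))) q"
    by (simp add: pmf_map vimage_def del: hist_pmf.simps)
  also have "map_pmf (\<lambda>h. fst (last h)) (hist_pmf \<delta> \<sigma> d0 (Suc i)) = state_pmf \<delta> \<sigma> d0 i"
    by (simp add: state_pmf_def occ_pmf_def map_bind_pmf map_pmf_comp)
  finally show ?thesis .
qed

lemma mass_state_dist:
  fixes \<delta> :: "('q::finite, 'a::finite) mdp"
  shows "mass (state_dist \<delta> \<sigma> d0 i) T = measure (state_pmf \<delta> \<sigma> d0 i) T"
  by (simp add: mass_def state_dist_eq_pmf measure_measure_pmf_finite)

section \<open>One-step recursion of the state distributions\<close>

lemma map_fst_step:
  "map_pmf fst (step \<delta> \<sigma> d0 i \<omega>) = (case i of 0 \<Rightarrow> d0 | Suc k \<Rightarrow> case_prod \<delta> (\<omega> k))"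
  by (simp add: step_def map_bind_pmf map_pmf_comp bind_return_pmf')

lemma state_pmf_0: "state_pmf \<delta> \<sigma> d0 0 = d0"
  by (simp add: state_pmf_def occ_pmf_def bind_return_pmf map_fst_step)

lemma state_pmf_Suc: "state_pmf \<delta> \<sigma> d0 (Suc i) = occ_pmf \<delta> \<sigma> d0 i \<bind> case_prod \<delta>"
proof -
  have "state_pmf \<delta> \<sigma> d0 (Suc i) = hist_pmf \<delta> \<sigma> d0 (Suc i) \<bind> (\<lambda>h. case_prod \<delta> (h ! i))"
    by (simp add: state_pmf_def occ_pmf_def map_bind_pmf map_fst_step)
  also have "\<dots> = hist_pmf \<delta> \<sigma> d0 i \<bind> (\<lambda>h. step \<delta> \<sigma> d0 i (nth h) \<bind> (\<lambda>p. case_prod \<delta> ((h @ [p]) ! i)))"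
    by (simp add: bind_assoc_pmf bind_map_pmf)
  also have "\<dots> = hist_pmf \<delta> \<sigma> d0 i \<bind> (\<lambda>h. step \<delta> \<sigma> d0 i (nth h) \<bind> case_prod \<delta>)"
  proof (rule bind_pmf_cong[OF refl])
    fix h assume "h \<in> set_pmf (hist_pmf \<delta> \<sigma> d0 i)"
    then have "length h = i" by (rule length_hist_pmf)
    then show "step \<delta> \<sigma> d0 i (nth h) \<bind> (\<lambda>p. case_prod \<delta> ((h @ [p]) ! i)) =
        step \<delta> \<sigma> d0 i (nth h) \<bind> case_prod \<delta>"
      by (auto simp: nth_append intro!: bind_pmf_cong)
  qed
  finally show ?thesis by (simp add: occ_pmf_def bind_assoc_pmf)
qed

text \<open>Only histories of length \<open>i\<close> are constrained, so strategies that become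
  memoryless from some position on are covered.\<close>

lemma state_pmf_Suc_memoryless:
  assumes "\<And>h q. length h = i \<Longrightarrow> \<sigma> h q = return_pmf (f q)"
  shows "state_pmf \<delta> \<sigma> d0 (Suc i) = state_pmf \<delta> \<sigma> d0 i \<bind> (\<lambda>q. \<delta> q (f q))"
proof -
  have "step \<delta> \<sigma> d0 i \<omega> = map_pmf (\<lambda>q. (q, f q)) (map_pmf fst (step \<delta> \<sigma> d0 i \<omega>))" for \<omega>
    unfolding map_fst_step unfolding step_def using assms
    by (simp add: map_pmf_def bind_return_pmf)
  then have "occ_pmf \<delta> \<sigma> d0 i = map_pmf (\<lambda>q. (q, f q)) (state_pmf \<delta> \<sigma> d0 i)"
    unfolding state_pmf_def occ_pmf_def map_bind_pmf by simp
  then show ?thesis by (simp add: state_pmf_Suc bind_map_pmf)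
qed

text \<open>The state at position \<open>m\<close> is drawn before the action at \<open>m\<close>,
  so a strategy may be switched exactly at \<open>m\<close>.\<close>

lemma state_pmf_cong:
  assumes "\<And>h q. length h < m \<Longrightarrow> \<sigma> h q = \<sigma>' h q"
  shows "state_pmf \<delta> \<sigma> d0 m = state_pmf \<delta> \<sigma>' d0 m"
proof -
  have st: "step \<delta> \<sigma> d0 i \<omega> = step \<delta> \<sigma>' d0 i \<omega>" if "i < m" for i \<omega>
    using assms that by (simp add: step_def)
  have hist: "i \<le> m \<Longrightarrow> hist_pmf \<delta> \<sigma> d0 i = hist_pmf \<delta> \<sigma>' d0 i" for i
    by (induction i) (simp_all add: st)
  show ?thesis
  proof (cases m)
    case 0
    then show ?thesis by (simp add: state_pmf_0)
  next
    case (Suc k)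
    then show ?thesis by (simp add: state_pmf_Suc occ_pmf_def hist st)
  qed
qed

section \<open>Expectations along one transition\<close>

lemma expectation_bind_finite:
  fixes p :: "'b::finite pmf" and K :: "'b \<Rightarrow> 'c::finite pmf" and h :: "'c \<Rightarrow> real"
  shows "measure_pmf.expectation (p \<bind> K) h =
    measure_pmf.expectation p (\<lambda>x. measure_pmf.expectation (K x) h)"
  by (subst pmf_expectation_bind[where A = UNIV])
    (auto simp: integral_measure_pmf_real[where A = UNIV] mult.commute)

lemma expectation_mono_finite:
  fixes p :: "'b::finite pmf" and g h :: "'b \<Rightarrow> real"
  assumes "\<And>x. x \<in> set_pmf p \<Longrightarrow> g x \<le> h x"
  shows "measure_pmf.expectation p g \<le> measure_pmf.expectation p h"
  by (rule integral_mono_AE) (auto simp: AE_measure_pmf_iff integrable_measure_pmf_finite assms)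

text \<open>The hypothesis ranges over all actions, so the bound holds for every strategy. With
  \<open>g = h\<close> it is a submartingale inequality; \<open>unsafe_step\<close> needs two
  different functions.\<close>

lemma expectation_state_pmf_step:
  fixes \<delta> :: "('q::finite, 'a::finite) mdp" and g h :: "'q \<Rightarrow> real"
  assumes "\<And>q a. g q \<le> measure_pmf.expectation (\<delta> q a) h"
  shows "measure_pmf.expectation (state_pmf \<delta> \<sigma> d0 i) g \<le>
    measure_pmf.expectation (state_pmf \<delta> \<sigma> d0 (Suc i)) h"
proof -
  have "measure_pmf.expectation (state_pmf \<delta> \<sigma> d0 i) g =
      measure_pmf.expectation (occ_pmf \<delta> \<sigma> d0 i) (\<lambda>p. g (fst p))"
    by (simp add: state_pmf_def)
  also have "\<dots> \<le> measure_pmf.expectation (state_pmf \<delta> \<sigma> d0 (Suc i)) h"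
    unfolding state_pmf_Suc expectation_bind_finite
    by (rule expectation_mono_finite) (simp add: assms split: prod.split)
  finally show ?thesis .
qed

lemma pmf_mult_le_expectation:
  fixes p :: "'b::finite pmf" and h :: "'b \<Rightarrow> real"
  assumes "\<And>x. 0 \<le> h x"
  shows "pmf p y * h y \<le> measure_pmf.expectation p h"
proof -
  have "measure_pmf.expectation p h = (\<Sum>x\<in>UNIV. h x * pmf p x)"
    by (rule integral_measure_pmf_real) auto
  moreover have "h y * pmf p y \<le> (\<Sum>x\<in>UNIV. h x * pmf p x)"
    by (rule member_le_sum) (auto simp: assms)
  ultimately show ?thesis by (simp add: mult.commute)
qed


lemma expectation_indicator_pmf: "measure_pmf.expectation p (indicator A) = measure p A"
  by simp

lemma measure_pmf_pos_iff: "measure_pmf.prob p A > 0 \<longleftrightarrow> set_pmf p \<inter> A \<noteq> {}"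
  by (metis measure_pmf_zero_iff measure_nonneg order_less_le)

lemma measure_pmf_eq_1_iff: "measure_pmf.prob p A = 1 \<longleftrightarrow> set_pmf p \<subseteq> A"
  by (metis AE_measure_pmf_iff measure_pmf.prob_eq_1 UNIV_I sets_measure_pmf subset_iff)

subsection \<open>Minimal positive probabilities\<close>

lemma min_trans_prob_facts:
  fixes \<delta> :: "('q::finite, 'a::finite) mdp"
  shows min_trans_prob_le: "q' \<in> set_pmf (\<delta> q a) \<Longrightarrow> min_trans_prob \<delta> \<le> pmf (\<delta> q a) q'"
    and min_trans_prob_pos: "0 < min_trans_prob \<delta>"
    and min_trans_prob_le_1: "min_trans_prob \<delta> \<le> 1"
proof -
  let ?A = "{pmf (\<delta> q a) q' | q a q'. pmf (\<delta> q a) q' > 0}"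
  have "?A \<subseteq> (\<Union>q a. range (pmf (\<delta> q a)))" by auto
  then have fin: "finite ?A" by (rule finite_subset) simp
  \<comment> \<open>Types are inhabited, so the set whose minimum is taken is nonempty.\<close>
  obtain q :: 'q and a :: 'a where "True" by simp
  obtain q' where q': "q' \<in> set_pmf (\<delta> q a)" using set_pmf_not_empty by fast
  then have ne: "?A \<noteq> {}" by (auto simp: pmf_positive_iff)
  show le: "min_trans_prob \<delta> \<le> pmf (\<delta> q a) q'" if "q' \<in> set_pmf (\<delta> q a)" for q a q'
    unfolding min_trans_prob_def using that
    by (intro Min_le[OF fin]) (auto simp: pmf_positive_iff)
  show "0 < min_trans_prob \<delta>"
    unfolding min_trans_prob_def using Min_in[OF fin ne] by auto
  show "min_trans_prob \<delta> \<le> 1"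
    using le[OF q'] pmf_le_1[of "\<delta> q a" q'] by linarith
qed

lemma min_init_prob_facts:
  fixes d0 :: "'q::finite pmf"
  shows min_init_prob_le: "q \<in> set_pmf d0 \<Longrightarrow> min_init_prob d0 \<le> pmf d0 q"
    and min_init_prob_pos: "0 < min_init_prob d0"
proof -
  let ?A = "{pmf d0 q | q. pmf d0 q > 0}"
  have fin: "finite ?A" by simp
  obtain q' where "q' \<in> set_pmf d0" using set_pmf_not_empty by fast
  then have ne: "?A \<noteq> {}" by (auto simp: pmf_positive_iff)
  show "min_init_prob d0 \<le> pmf d0 q" if "q \<in> set_pmf d0" for q
    unfolding min_init_prob_def using that by (intro Min_le[OF fin]) (auto simp: pmf_positive_iff)
  show "0 < min_init_prob d0"
    unfolding min_init_prob_def using Min_in[OF fin ne] by auto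
qed

lemma min_init_prob_le_measure:
  fixes d0 :: "'q::finite pmf"
  assumes "set_pmf d0 \<inter> A \<noteq> {}"
  shows "min_init_prob d0 \<le> measure_pmf.prob d0 A"
proof -
  obtain q where q: "q \<in> set_pmf d0" "q \<in> A" using assms by auto
  have "min_init_prob d0 \<le> measure_pmf.prob d0 {q}"
    using min_init_prob_le[OF q(1)] by (simp add: measure_pmf_single)
  also have "\<dots> \<le> measure_pmf.prob d0 A"
    using q by (intro measure_pmf.finite_measure_mono) auto
  finally show ?thesis .
qed

subsection \<open>Safety\<close>

text \<open>Approximation from above of a greatest fixed point; the index counts the steps during
  which \<open>T\<close> can surely be kept.\<close>

primrec safe :: "('q, 'a) mdp \<Rightarrow> 'q set \<Rightarrow> nat \<Rightarrow> 'q set" where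
  "safe \<delta> T 0 = T"
| "safe \<delta> T (Suc k) = {q \<in> T. \<exists>a. set_pmf (\<delta> q a) \<subseteq> safe \<delta> T k}"

lemma safe_subset: "safe \<delta> T k \<subseteq> T"
  by (cases k) auto

text \<open>Once two consecutive sets agree the chain is constant; before that each step adds an
  element of \<open>S\<close>, so there are at most \<open>card S\<close> strict steps.\<close>

lemma increasing_sets_stable:
  fixes f :: "nat \<Rightarrow> 'b set"
  assumes "mono f" "\<And>i. f i \<subseteq> S" "finite S"
    and "\<And>i. f i = f (Suc i) \<Longrightarrow> f (Suc i) = f (Suc (Suc i))"
    and "card S \<le> k"
  shows "f (Suc k) = f k"
proof -
  have "finite (range f)"
    by (rule finite_subset[of _ "Pow S"]) (use assms in auto)
  then have ex: "\<exists>N. (\<forall>n\<le>N. \<forall>m\<le>N. m < n \<longrightarrow> f m \<subset> f n) \<and> (\<forall>n\<ge>N. f N = f n)"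
    using assms by (intro finite_mono_remains_stable_implies_strict_prefix) auto
  have top: "f (card S) = (\<Union>n. f n)"
    by (rule finite_mono_strict_prefix_implies_finite_fixpoint[OF assms(2,3) ex])
  have "f k = (\<Union>n. f n)" if "card S \<le> k" for k
    using monoD[OF assms(1) that] top by auto
  then show ?thesis using assms(5) by (metis le_SucI)
qed

text \<open>Complements in \<open>T\<close> turn the decreasing chain into an increasing one, whose
  strict steps are bounded by \<open>card T\<close>.\<close>

lemma safe_stable:
  fixes T :: "'q::finite set"
  assumes "card T \<le> k"
  shows "safe \<delta> T (Suc k) = safe \<delta> T k"
proof -
  have dec: "safe \<delta> T (Suc i) \<subseteq> safe \<delta> T i" for i
  proof (induction i)
    case (Suc i)
    then have "{q \<in> T. \<exists>a. set_pmf (\<delta> q a) \<subseteq> safe \<delta> T (Suc i)} \<subseteq>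
        {q \<in> T. \<exists>a. set_pmf (\<delta> q a) \<subseteq> safe \<delta> T i}" by blast
    then show ?case by simp
  qed auto
  have *: "T - safe \<delta> T (Suc k) = T - safe \<delta> T k"
  proof (rule increasing_sets_stable[where S = T and k = k])
    show "mono (\<lambda>i. T - safe \<delta> T i)" using dec by (intro mono_iff_le_Suc[THEN iffD2]) blast
    show "T - safe \<delta> T (Suc i) = T - safe \<delta> T (Suc (Suc i))"
      if "T - safe \<delta> T i = T - safe \<delta> T (Suc i)" for i
    proof -
      have "safe \<delta> T i = safe \<delta> T (Suc i)"
        using that safe_subset[of \<delta> T i] safe_subset[of \<delta> T "Suc i"] by blast
      then show ?thesis by simp
    qed
  qed (use assms in auto)
  show ?thesis using * safe_subset[of \<delta> T k] safe_subset[of \<delta> T "Suc k"] by blast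
qed

text \<open>From a state outside \<^term>\<open>safe \<delta> T (Suc k)\<close> every action leaves \<^term>\<open>T\<close> now or leads outside
  \<^term>\<open>safe \<delta> T k\<close> with probability at least \<^term>\<open>min_trans_prob \<delta>\<close>.\<close>

lemma unsafe_step:
  fixes \<delta> :: "('q::finite, 'a::finite) mdp"
  defines "\<alpha> \<equiv> min_trans_prob \<delta>"
  shows "\<alpha> * measure (state_pmf \<delta> \<sigma> d0 m) (- safe \<delta> T (Suc k)) \<le>
    \<alpha> * measure (state_pmf \<delta> \<sigma> d0 m) (- T) + measure (state_pmf \<delta> \<sigma> d0 (Suc m)) (- safe \<delta> T k)"
proof -
  \<comment> \<open>Since \<open>safe\<close> lies in \<open>T\<close>, \<open>?g\<close> is
    \<alpha> on \<open>T - safe \<delta> T (Suc k)\<close> and 0 elsewhere.\<close>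
  let ?g = "\<lambda>q. \<alpha> * indicator (- safe \<delta> T (Suc k)) q - \<alpha> * indicator (- T) q :: real"
  have "?g q \<le> measure_pmf.expectation (\<delta> q a) (indicator (- safe \<delta> T k))" for q a
  proof (cases "q \<in> T \<and> q \<notin> safe \<delta> T (Suc k)")
    case True
    then obtain q' where q': "q' \<in> set_pmf (\<delta> q a)" "q' \<notin> safe \<delta> T k" by auto
    have "\<alpha> \<le> pmf (\<delta> q a) q' * indicator (- safe \<delta> T k) q'"
      using q' min_trans_prob_le unfolding \<alpha>_def by simp
    also have "\<dots> \<le> measure_pmf.expectation (\<delta> q a) (indicator (- safe \<delta> T k))"
      by (rule pmf_mult_le_expectation) simp
    finally show ?thesis using True by simp
  next
    case False
    have "?g q \<le> 0"
      using False min_trans_prob_pos[of \<delta>] unfolding \<alpha>_def by (auto simp: indicator_def)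
    then show ?thesis
      unfolding expectation_indicator_pmf using measure_nonneg order_trans by blast
  qed
  then have "measure_pmf.expectation (state_pmf \<delta> \<sigma> d0 m) ?g \<le>
      measure_pmf.expectation (state_pmf \<delta> \<sigma> d0 (Suc m)) (indicator (- safe \<delta> T k))"
    by (rule expectation_state_pmf_step)
  moreover have "measure_pmf.expectation (state_pmf \<delta> \<sigma> d0 m) ?g =
      \<alpha> * measure (state_pmf \<delta> \<sigma> d0 m) (- safe \<delta> T (Suc k)) -
      \<alpha> * measure (state_pmf \<delta> \<sigma> d0 m) (- T)"
    by (subst Bochner_Integration.integral_diff) (simp_all add: integrable_measure_pmf_finite)
  ultimately show ?thesis by simp
qed

text \<open>Iterates \<open>unsafe_step\<close>: mass still in \<open>T\<close> moves down one stage
  at the cost of a factor \<alpha>, and stage 0 is \<open>T\<close> itself.\<close>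

lemma unsafe_le_sum:
  fixes \<delta> :: "('q::finite, 'a::finite) mdp"
  shows "min_trans_prob \<delta> ^ k * measure (state_pmf \<delta> \<sigma> d0 m) (- safe \<delta> T k) \<le>
    (\<Sum>i\<le>k. measure (state_pmf \<delta> \<sigma> d0 (m + i)) (- T))"
proof (induction k arbitrary: m)
  case 0
  show ?case by simp
next
  case (Suc k)
  let ?\<alpha> = "min_trans_prob \<delta>" and ?p = "\<lambda>m. measure_pmf.prob (state_pmf \<delta> \<sigma> d0 m)"
  have \<alpha>: "0 < ?\<alpha>" "?\<alpha> \<le> 1" by (rule min_trans_prob_pos min_trans_prob_le_1)+
  have "?\<alpha> ^ Suc k * ?p m (- safe \<delta> T (Suc k)) = ?\<alpha> ^ k * (?\<alpha> * ?p m (- safe \<delta> T (Suc k)))"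
    by simp
  also have "\<dots> \<le> ?\<alpha> ^ k * (?\<alpha> * ?p m (- T) + ?p (Suc m) (- safe \<delta> T k))"
    using \<alpha> by (intro mult_left_mono unsafe_step) simp
  also have "\<dots> = ?\<alpha> ^ Suc k * ?p m (- T) + ?\<alpha> ^ k * ?p (Suc m) (- safe \<delta> T k)"
    by (simp add: algebra_simps)
  \<comment> \<open>The coefficient \<open>\<alpha> ^ Suc k\<close> of the mass outside
    \<open>T\<close> now is at most 1 and is dropped.\<close>
  also have "\<dots> \<le> ?p m (- T) + (\<Sum>i\<le>k. ?p (Suc m + i) (- T))"
    using \<alpha> power_le_one[of ?\<alpha> "Suc k"] by (intro add_mono mult_left_le_one_le Suc.IH) auto
  also have "\<dots> = (\<Sum>i\<le>Suc k. ?p (m + i) (- T))"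
    by (subst sum.atMost_Suc_shift) simp
  finally show ?case .
qed

text \<open>Follow \<sigma> before \<open>m\<close>, then a memoryless choice that never leaves
  \<open>S\<close>. Applied contrapositively: without sure synchronization, some mass lies outside
  \<open>S\<close>.\<close>

lemma safe_strategy:
  fixes \<delta> :: "('q::finite, 'a::finite) mdp"
  assumes closed: "\<forall>q\<in>S. \<exists>a. set_pmf (\<delta> q a) \<subseteq> S" and "S \<subseteq> T"
    and start: "set_pmf (state_pmf \<delta> \<sigma> d0 m) \<subseteq> S"
  shows "\<exists>\<sigma>'. \<forall>i\<ge>m. mass (state_dist \<delta> \<sigma>' d0 i) T = 1"
proof -
  obtain f where f: "\<And>q. q \<in> S \<Longrightarrow> set_pmf (\<delta> q (f q)) \<subseteq> S" using closed by metis
  define \<sigma>' where "\<sigma>' h q = (if length h < m then \<sigma> h q else return_pmf (f q))" for h q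
  have "set_pmf (state_pmf \<delta> \<sigma>' d0 i) \<subseteq> S" if "m \<le> i" for i
    using that
  proof (induction i rule: dec_induct)
    case base
    have "state_pmf \<delta> \<sigma>' d0 m = state_pmf \<delta> \<sigma> d0 m"
      by (rule state_pmf_cong) (simp add: \<sigma>'_def)
    then show ?case using start by simp
  next
    case (step i)
    have "state_pmf \<delta> \<sigma>' d0 (Suc i) = state_pmf \<delta> \<sigma>' d0 i \<bind> (\<lambda>q. \<delta> q (f q))"
      using step by (intro state_pmf_Suc_memoryless) (simp add: \<sigma>'_def)
    then show ?case using step f by (auto; blast)
  qed
  then show ?thesis
    using \<open>S \<subseteq> T\<close> by (intro exI[of _ \<sigma>']) (auto simp: mass_state_dist measure_pmf_eq_1_iff)
qed

subsection \<open>Almost-sure reachability\<close>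

text \<open>Positive-probability attractor of \<open>S\<close> by actions that cannot lead into
  \<open>B\<close>; \<open>j\<close> bounds the number of steps.\<close>

primrec attr :: "('q, 'a) mdp \<Rightarrow> 'q set \<Rightarrow> 'q set \<Rightarrow> nat \<Rightarrow> 'q set" where
  "attr \<delta> S B 0 = S"
| "attr \<delta> S B (Suc j) = attr \<delta> S B j \<union>
     {q. \<exists>a. set_pmf (\<delta> q a) \<inter> B = {} \<and> set_pmf (\<delta> q a) \<inter> attr \<delta> S B j \<noteq> {}}"

text \<open>Each stage collects the states that cannot reach \<open>S\<close> with positive
  probability without risking the previous stage. The limit is the complement of the almost-sure
  winning region for reaching \<open>S\<close>.\<close>

primrec losing :: "('q, 'a) mdp \<Rightarrow> 'q set \<Rightarrow> nat \<Rightarrow> 'q set" where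
  "losing \<delta> S 0 = {}"
| "losing \<delta> S (Suc k) = - (\<Union>j. attr \<delta> S (losing \<delta> S k) j)"

lemma attr_antimono:
  assumes "B \<subseteq> B'"
  shows "attr \<delta> S B' j \<subseteq> attr \<delta> S B j"
proof (induction j)
  case (Suc j)
  then show ?case using assms by simp blast
qed simp

text \<open>A larger forbidden set shrinks the attractor, so the stages increase; each is a function
  of the one before, so a stall is permanent.\<close>

lemma losing_stable:
  fixes \<delta> :: "('q::finite, 'a) mdp"
  shows "losing \<delta> S (Suc CARD('q)) = losing \<delta> S CARD('q)"
proof (rule increasing_sets_stable[where S = UNIV])
  have "losing \<delta> S i \<subseteq> losing \<delta> S (Suc i)" for i
  proof (induction i)
    case (Suc i)
    have "(\<Union>j. attr \<delta> S (losing \<delta> S (Suc i)) j) \<subseteq> (\<Union>j. attr \<delta> S (losing \<delta> S i) j)"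
      by (intro UN_mono attr_antimono Suc) simp
    then show ?case by (simp only: losing.simps Compl_subset_Compl_iff)
  qed simp
  then show "mono (losing \<delta> S)" by (intro mono_iff_le_Suc[THEN iffD2]) blast
  show "losing \<delta> S (Suc i) = losing \<delta> S (Suc (Suc i))"
    if "losing \<delta> S i = losing \<delta> S (Suc i)" for i
    unfolding losing.simps(2)[of \<delta> S "Suc i"] that[symmetric]
    unfolding losing.simps(2)[symmetric] by (rule that)
qed simp_all

lemma losing_Suc_disjoint: "losing \<delta> S (Suc k) \<inter> S = {}"
proof -
  have "S \<subseteq> (\<Union>j. attr \<delta> S (losing \<delta> S k) j)" by (metis UN_upper UNIV_I attr.simps(1))
  then show ?thesis by auto
qed

text \<open>An action violating both alternatives avoids \<open>losing \<delta> S k\<close> and has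
  a successor in the attractor, so \<open>q\<close> would be attracted too.\<close>

lemma losing_Suc_successors:
  assumes "q \<in> losing \<delta> S (Suc k)"
  shows "set_pmf (\<delta> q a) \<inter> losing \<delta> S k \<noteq> {} \<or> set_pmf (\<delta> q a) \<subseteq> losing \<delta> S (Suc k)"
proof (rule ccontr)
  assume "\<not> ?thesis"
  then obtain q' j where "set_pmf (\<delta> q a) \<inter> losing \<delta> S k = {}" "q' \<in> set_pmf (\<delta> q a)"
    "q' \<in> attr \<delta> S (losing \<delta> S k) j" by auto
  then have "q \<in> attr \<delta> S (losing \<delta> S k) (Suc j)" by auto
  then show False using assms unfolding losing.simps by blast
qed

text \<open>Assigning \<open>\<alpha>\<^sup>k\<close> to the states that enter \<^term>\<open>losing \<delta> S\<close> at stage \<open>k + 1\<close>, and \<open>0\<close> to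
  the states that never do, gives a submartingale under every strategy, and it vanishes on \<open>S\<close>.\<close>

lemma losing_lower_bound:
  fixes \<delta> :: "('q::finite, 'a::finite) mdp"
  assumes q: "q \<in> losing \<delta> S (Suc k)"
  shows "pmf d0 q * min_trans_prob \<delta> ^ k \<le> measure (state_pmf \<delta> \<sigma> d0 m) (- S)"
proof -
  define \<alpha> where "\<alpha> = min_trans_prob \<delta>"
  have \<alpha>: "0 < \<alpha>" "\<alpha> \<le> 1"
    unfolding \<alpha>_def by (rule min_trans_prob_pos min_trans_prob_le_1)+
  let ?L = "\<lambda>q k. q \<in> losing \<delta> S (Suc k)"
  define h where "h q = (if \<exists>k. ?L q k then \<alpha> ^ (LEAST k. ?L q k) else 0)" for q
  have h_nonneg: "0 \<le> h q" for q using \<alpha> by (simp add: h_def)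
  have h_ge: "\<alpha> ^ k \<le> h q" if "?L q k" for q k
  proof -
    have "\<alpha> ^ k \<le> \<alpha> ^ (LEAST k. ?L q k)"
      using \<alpha> Least_le[of "?L q", OF that] by (intro power_decreasing) auto
    then show ?thesis using that unfolding h_def by (auto simp del: losing.simps)
  qed
  have h_le: "h q \<le> indicator (- S) q" for q
    using losing_Suc_disjoint[of \<delta> S] \<alpha>
    by (auto simp: h_def indicator_def power_le_one simp del: losing.simps)
  have sub: "h q \<le> measure_pmf.expectation (\<delta> q a) h" for q a
  proof (cases "\<exists>k. ?L q k")
    case True
    define k where "k = (LEAST k. ?L q k)"
    have Lk: "?L q k" unfolding k_def using True by (rule LeastI_ex)
    have hq: "h q = \<alpha> ^ k" using True by (simp add: h_def k_def del: losing.simps)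
    from losing_Suc_successors[OF Lk, of a] show ?thesis
    proof
      assume "set_pmf (\<delta> q a) \<inter> losing \<delta> S k \<noteq> {}"
      \<comment> \<open>Stage 0 is empty, so \<open>k\<close> is a successor; the lost factor
        \<alpha> is paid by the probability of moving to \<open>q'\<close>.\<close>
      then obtain q' j where q': "q' \<in> set_pmf (\<delta> q a)" "k = Suc j" "?L q' j"
        by (cases k) (auto simp del: losing.simps(2))
      have "\<alpha> \<le> pmf (\<delta> q a) q'" unfolding \<alpha>_def using q'(1) by (rule min_trans_prob_le)
      moreover have "h q = \<alpha> * \<alpha> ^ j" by (simp add: hq q')
      ultimately have "h q \<le> pmf (\<delta> q a) q' * h q'"
        using \<alpha> h_ge[OF q'(3)] by (auto intro: mult_mono)
      also have "\<dots> \<le> measure_pmf.expectation (\<delta> q a) h"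
        by (rule pmf_mult_le_expectation) (rule h_nonneg)
      finally show ?thesis .
    next
      assume "set_pmf (\<delta> q a) \<subseteq> losing \<delta> S (Suc k)"
      then have "measure_pmf.expectation (\<delta> q a) (\<lambda>_. \<alpha> ^ k) \<le> measure_pmf.expectation (\<delta> q a) h"
        by (intro expectation_mono_finite h_ge) auto
      then show ?thesis by (simp add: hq)
    qed
  next
    case False
    then show ?thesis
      using Bochner_Integration.integral_nonneg[of "\<delta> q a" h] h_nonneg
      by (simp add: h_def del: losing.simps)
  qed
  have "pmf d0 q * \<alpha> ^ k \<le> pmf d0 q * h q"
    using h_ge[OF q] by (intro mult_left_mono) auto
  also have "\<dots> \<le> measure_pmf.expectation (state_pmf \<delta> \<sigma> d0 0) h"
    unfolding state_pmf_0 by (rule pmf_mult_le_expectation) (rule h_nonneg)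
  also have "\<dots> \<le> measure_pmf.expectation (state_pmf \<delta> \<sigma> d0 m) h"
    by (induction m) (auto intro: order_trans expectation_state_pmf_step[OF sub])
  also have "\<dots> \<le> measure_pmf.expectation (state_pmf \<delta> \<sigma> d0 m) (indicator (- S))"
    by (intro expectation_mono_finite h_le)
  finally show ?thesis by (simp add: \<alpha>_def)
qed

text \<open>With \<open>r\<close> the attractor rank, the potential \<open>1 - (\<alpha>/2)\<^sup>r\<close> contracts under the memoryless
  strategy that follows the attractor: the successor of smaller rank alone contributes
  \<open>\<alpha> (\<alpha>/2)\<^sup>r\<^sup>-\<^sup>1 = 2y\<close> to the expectation of \<open>(\<alpha>/2)\<^sup>r\<close>, where \<open>y = (\<alpha>/2)\<^sup>r\<close>, and
  \<open>1 - 2y \<le> (1 - y)\<^sup>2\<close>.\<close>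

lemma almost_sure_strongly_sync_attr:
  fixes \<delta> :: "('q::finite, 'a::finite) mdp"
  assumes closed: "\<forall>q\<in>S. \<exists>a. set_pmf (\<delta> q a) \<subseteq> S" and "S \<subseteq> T"
    and W: "W = (\<Union>j. attr \<delta> S (- W) j)"
    and start: "set_pmf d0 \<subseteq> W"
  shows "almost_sure_strongly_sync \<delta> d0 T"
proof -
  define \<alpha> where "\<alpha> = min_trans_prob \<delta>"
  have \<alpha>: "0 < \<alpha>" "\<alpha> \<le> 1"
    unfolding \<alpha>_def by (rule min_trans_prob_pos min_trans_prob_le_1)+
  let ?A = "attr \<delta> S (- W)"
  define r where "r q = (LEAST j. q \<in> ?A j)" for q
  have r_le: "r q \<le> j" if "q \<in> ?A j" for q j
    unfolding r_def using that by (rule Least_le)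
  have in_A: "q \<in> ?A (r q)" if "q \<in> W" for q
  proof -
    have "q \<in> (\<Union>j. ?A j)" using that by (subst (asm) W)
    then show ?thesis unfolding r_def by (auto intro: LeastI)
  qed
  have SW: "S \<subseteq> W"
  proof
    fix q assume "q \<in> S"
    then have "q \<in> ?A 0" by simp
    then show "q \<in> W" by (subst W) blast
  qed
  have r_S: "r q = 0" if "q \<in> S" for q using r_le[of q 0] that by simp
  \<comment> \<open>One memoryless choice serves both goals: stay in \<open>S\<close> once there,
    and otherwise stay in \<open>W\<close> with a chance of lowering the rank.\<close>
  have "\<exists>a. (q \<in> S \<longrightarrow> set_pmf (\<delta> q a) \<subseteq> S) \<and> (q \<in> W - S \<longrightarrow> set_pmf (\<delta> q a) \<subseteq> W \<and>
      (\<exists>q'\<in>set_pmf (\<delta> q a). r q' < r q))" for q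
  proof (cases "q \<in> W - S")
    case True
    then have "r q \<noteq> 0" using in_A[of q] by (cases "r q") auto
    then obtain j where j: "r q = Suc j" by (cases "r q") auto
    have "q \<notin> ?A j" using r_le[of q j] j by auto
    then obtain a where a: "set_pmf (\<delta> q a) \<inter> - W = {}" "set_pmf (\<delta> q a) \<inter> ?A j \<noteq> {}"
      using in_A[of q] True j by auto
    then show ?thesis using True j r_le le_imp_less_Suc by fastforce
  qed (use closed in auto)
  then obtain f where f_S: "\<And>q. q \<in> S \<Longrightarrow> set_pmf (\<delta> q (f q)) \<subseteq> S"
    and f_W: "\<And>q. q \<in> W - S \<Longrightarrow> set_pmf (\<delta> q (f q)) \<subseteq> W"
    and f_r: "\<And>q. q \<in> W - S \<Longrightarrow> \<exists>q'\<in>set_pmf (\<delta> q (f q)). r q' < r q"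
    by metis
  define x where "x q = (\<alpha> / 2) ^ r q" for q
  \<comment> \<open>The maximal rank gives a bound on the potential below 1 uniformly in the state,
    hence a common contraction factor.\<close>
  define c where "c = 1 - (\<alpha> / 2) ^ Max (range r)"
  have x01: "0 < x q" "x q \<le> 1" for q
    using \<alpha> by (auto simp: x_def intro!: power_le_one)
  have x_ge: "1 - x q \<le> c" for q
    unfolding c_def x_def using \<alpha> by (simp add: power_decreasing)
  have c: "0 \<le> c" "c < 1" using \<alpha> by (auto simp: c_def intro!: power_le_one)
  have contract: "measure_pmf.expectation (\<delta> q (f q)) (\<lambda>q. 1 - x q) \<le> c * (1 - x q)"
    if "q \<in> W" for q
  proof (cases "q \<in> S")
    case True
    then have "measure_pmf.expectation (\<delta> q (f q)) (\<lambda>q. 1 - x q) \<le>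
        measure_pmf.expectation (\<delta> q (f q)) (\<lambda>q. 0)"
      using f_S[of q] by (intro expectation_mono_finite) (auto simp: x_def r_S subset_iff)
    then show ?thesis using True by (simp add: x_def r_S)
  next
    case False
    with that obtain q' where q': "q' \<in> set_pmf (\<delta> q (f q))" "r q' < r q" using f_r by blast
    then obtain j where j: "r q = Suc j" "r q' \<le> j" by (cases "r q") auto
    have "\<alpha> \<le> pmf (\<delta> q (f q)) q'" unfolding \<alpha>_def using q'(1) by (rule min_trans_prob_le)
    moreover have "(\<alpha> / 2) ^ j \<le> x q'"
      unfolding x_def using \<alpha> j by (intro power_decreasing) auto
    moreover have "2 * x q = \<alpha> * (\<alpha> / 2) ^ j" by (simp add: x_def j)
    ultimately have "2 * x q \<le> pmf (\<delta> q (f q)) q' * x q'"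
      using \<alpha> by (auto intro: mult_mono)
    also have "\<dots> \<le> measure_pmf.expectation (\<delta> q (f q)) x"
      using x01 by (intro pmf_mult_le_expectation) (simp add: less_imp_le)
    finally have "measure_pmf.expectation (\<delta> q (f q)) (\<lambda>q. 1 - x q) \<le> 1 - 2 * x q"
      by (subst Bochner_Integration.integral_diff) (simp_all add: integrable_measure_pmf_finite)
    also have "\<dots> \<le> (1 - x q) * (1 - x q)" by (simp add: algebra_simps)
    also have "\<dots> \<le> c * (1 - x q)" using x_ge x01 by (intro mult_right_mono) auto
    finally show ?thesis .
  qed
  define \<sigma> :: "('q, 'a) strategy" where "\<sigma> = (\<lambda>h q. return_pmf (f q))"
  let ?p = "state_pmf \<delta> \<sigma> d0"
  have p_Suc: "?p (Suc i) = ?p i \<bind> (\<lambda>q. \<delta> q (f q))" for i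
    by (rule state_pmf_Suc_memoryless) (simp add: \<sigma>_def)
  have inv: "set_pmf (?p i) \<subseteq> W" for i
  proof (induction i)
    case 0
    show ?case using start by (simp add: state_pmf_0)
  next
    case (Suc i)
    have "set_pmf (\<delta> q (f q)) \<subseteq> W" if "q \<in> W" for q
      using f_S f_W SW that by (cases "q \<in> S") blast+
    then show ?case using Suc by (auto simp: p_Suc)
  qed
  have geo: "measure_pmf.expectation (?p i) (\<lambda>q. 1 - x q) \<le> c ^ i" for i
  proof (induction i)
    case 0
    have "measure_pmf.expectation (?p 0) (\<lambda>q. 1 - x q) \<le> measure_pmf.expectation (?p 0) (\<lambda>q. 1)"
      using x01 by (intro expectation_mono_finite) (simp add: less_imp_le)
    then show ?case by simp
  next
    case (Suc i)
    have "measure_pmf.expectation (?p (Suc i)) (\<lambda>q. 1 - x q) \<le>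
        measure_pmf.expectation (?p i) (\<lambda>q. c * (1 - x q))"
      unfolding p_Suc expectation_bind_finite
      using inv by (intro expectation_mono_finite contract) auto
    also have "\<dots> = c * measure_pmf.expectation (?p i) (\<lambda>q. 1 - x q)" by simp
    also have "\<dots> \<le> c * c ^ i" using c Suc by (intro mult_left_mono)
    finally show ?case by simp
  qed
  have mass_ge: "1 - 2 * c ^ i \<le> mass (state_dist \<delta> \<sigma> d0 i) T" for i
  proof -
    \<comment> \<open>Off \<open>S\<close> the rank is positive, so \<open>x q\<close> is at most
      1/2; this is where the factor 2 comes from.\<close>
    have "indicator (- T) q \<le> 2 * (1 - x q)" if "q \<in> W" for q
    proof (cases "q \<in> S")
      case True
      then show ?thesis using \<open>S \<subseteq> T\<close> x01[of q] by (auto simp: indicator_def)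
    next
      case False
      with that obtain q' where "r q' < r q" using f_r by blast
      then obtain j where "r q = Suc j" by (cases "r q") auto
      then have "x q \<le> 1 / 2"
        using \<alpha> power_le_one[of "\<alpha> / 2" j] mult_mono[of "\<alpha> / 2" "1 / 2" "(\<alpha> / 2) ^ j" 1]
        by (simp add: x_def)
      then show ?thesis by (simp add: indicator_def)
    qed
    then have "measure_pmf.expectation (?p i) (indicator (- T)) \<le>
        measure_pmf.expectation (?p i) (\<lambda>q. 2 * (1 - x q))"
      using inv by (intro expectation_mono_finite) auto
    also have "\<dots> = 2 * measure_pmf.expectation (?p i) (\<lambda>q. 1 - x q)"
      by (rule integral_mult_right_zero)
    also have "\<dots> \<le> 2 * c ^ i" using geo[of i] by simp
    finally have "measure_pmf.prob (?p i) (- T) \<le> 2 * c ^ i"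
      unfolding expectation_indicator_pmf .
    then show ?thesis
      using measure_pmf.prob_compl[of T "?p i"] by (simp add: mass_state_dist Compl_eq_Diff_UNIV)
  qed
  have lim: "(\<lambda>i. 2 * c ^ i) \<longlonglongrightarrow> 0"
    using c by (intro tendsto_mult_right_zero LIMSEQ_power_zero) auto
  show ?thesis
    unfolding almost_sure_strongly_sync_def
  proof (intro exI[of _ \<sigma>] allI impI)
    fix \<epsilon> :: real assume "0 < \<epsilon>"
    then have "eventually (\<lambda>i. 2 * c ^ i < \<epsilon>) sequentially"
      by (rule order_tendstoD(2)[OF lim])
    then obtain N where "\<forall>i\<ge>N. 2 * c ^ i < \<epsilon>" by (auto simp: eventually_sequentially)
    then show "\<exists>N. \<forall>i\<ge>N. 1 - \<epsilon> \<le> mass (state_dist \<delta> \<sigma> d0 i) T"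
      using mass_ge by (intro exI[of _ N]) (smt (verit))
  qed
qed

subsection \<open>Frequency of positions outside the target\<close>

text \<open>Pick a position in each window and start the next window one past it; the shift gives
  strict growth and still keeps gaps at most \<open>n\<close>.\<close>

lemma frequent_positions:
  fixes P :: "nat \<Rightarrow> bool"
  assumes "\<And>m. \<exists>i. m \<le> i \<and> i < m + n \<and> P i"
  shows "\<exists>i :: nat \<Rightarrow> nat. strict_mono i \<and> i 0 \<le> n \<and> (\<forall>j. i (Suc j) - i j \<le> n) \<and> (\<forall>j. P (i j))"
proof -
  obtain c where c: "\<And>m. m \<le> c m" "\<And>m. c m < m + n" "\<And>m. P (c m)" using assms by metis
  define i where "i = rec_nat (c 0) (\<lambda>_ k. c (Suc k))"
  have i: "i 0 = c 0" "\<And>j. i (Suc j) = c (Suc (i j))" by (simp_all add: i_def)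
  have "strict_mono i" using c(1) by (simp add: strict_mono_Suc_iff i Suc_le_lessD)
  moreover have "i 0 \<le> n" using c(2)[of 0] by (simp add: i)
  moreover have "i (Suc j) - i j \<le> n" for j using c(2)[of "Suc (i j)"] by (simp add: i)
  moreover have "P (i j)" for j by (cases j) (simp_all add: i c)
  ultimately show ?thesis by blast
qed

lemma exists_gt_of_sum:
  fixes f :: "nat \<Rightarrow> real"
  assumes "real n * e < (\<Sum>i<n. f i)"
  shows "\<exists>i<n. e < f i"
proof (rule ccontr)
  assume "\<not> ?thesis"
  then have "(\<Sum>i<n. f i) \<le> real (card {..<n}) * e" by (intro sum_bounded_above) force
  then show False using assms by simp
qed

text \<open>A proper subset has at most \<open>CARD('q) - 1\<close> elements, so that stage of
  \<open>safe\<close> is already closed. Stopping there yields the smaller exponent and a window of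
  exactly \<open>CARD('q)\<close> positions.\<close>

lemma safe_window:
  fixes \<delta> :: "('q::finite, 'a::finite) mdp"
  assumes "T \<noteq> UNIV"
  obtains S where "S \<subseteq> T" "\<forall>q\<in>S. \<exists>a. set_pmf (\<delta> q a) \<subseteq> S"
    and "\<forall>\<sigma> d0 m. min_trans_prob \<delta> ^ (CARD('q) - 1) * measure (state_pmf \<delta> \<sigma> d0 m) (- S) \<le>
      (\<Sum>i<CARD('q). measure (state_pmf \<delta> \<sigma> d0 (m + i)) (- T))"
proof
  let ?S = "safe \<delta> T (CARD('q) - 1)"
  have "card T < CARD('q)" using assms by (intro psubset_card_mono) auto
  then have stable: "safe \<delta> T (Suc (CARD('q) - 1)) = ?S" by (intro safe_stable) simp
  show "?S \<subseteq> T" by (rule safe_subset)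
  show "\<forall>q\<in>?S. \<exists>a. set_pmf (\<delta> q a) \<subseteq> ?S"
    using stable unfolding safe.simps by blast
  have "{..CARD('q) - 1} = {..<CARD('q)}" by (simp flip: lessThan_Suc_atMost)
  then show "\<forall>\<sigma> d0 m. min_trans_prob \<delta> ^ (CARD('q) - 1) * measure (state_pmf \<delta> \<sigma> d0 m) (- ?S) \<le>
      (\<Sum>i<CARD('q). measure (state_pmf \<delta> \<sigma> d0 (m + i)) (- T))"
    using unsafe_le_sum[where \<delta> = \<delta> and k = "CARD('q) - 1" and T = T] by simp
qed

text \<open>The complement of the stable losing set is a fixed point as in
  \<open>almost_sure_strongly_sync_attr\<close>, so \<open>d0\<close> must charge a losing state.
  Stage \<open>CARD('q)\<close> carries weight with exponent \<open>CARD('q) - 1\<close>.\<close>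

lemma not_reach_lower_bound:
  fixes \<delta> :: "('q::finite, 'a::finite) mdp"
  assumes "\<forall>q\<in>S. \<exists>a. set_pmf (\<delta> q a) \<subseteq> S" and "S \<subseteq> T"
    and "\<not> almost_sure_strongly_sync \<delta> d0 T"
  shows "min_init_prob d0 * min_trans_prob \<delta> ^ (CARD('q) - 1) \<le>
    measure (state_pmf \<delta> \<sigma> d0 m) (- S)"
proof -
  define B where "B = losing \<delta> S CARD('q)"
  have "- losing \<delta> S (Suc CARD('q)) = (\<Union>j. attr \<delta> S (losing \<delta> S CARD('q)) j)" by simp
  then have "- B = (\<Union>j. attr \<delta> S (- (- B)) j)"
    unfolding losing_stable B_def double_complement .
  then have "\<not> set_pmf d0 \<subseteq> - B"
    using almost_sure_strongly_sync_attr[OF assms(1,2)] assms(3) by blast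
  then obtain q where q: "q \<in> set_pmf d0" "q \<in> B" by auto
  have "q \<in> losing \<delta> S (Suc (CARD('q) - 1))"
    using q(2) unfolding B_def by (simp del: losing.simps)
  then have "pmf d0 q * min_trans_prob \<delta> ^ (CARD('q) - 1) \<le> measure (state_pmf \<delta> \<sigma> d0 m) (- S)"
    by (rule losing_lower_bound)
  moreover have "min_init_prob d0 * min_trans_prob \<delta> ^ (CARD('q) - 1) \<le>
      pmf d0 q * min_trans_prob \<delta> ^ (CARD('q) - 1)"
    using min_init_prob_le[OF q(1)] min_trans_prob_pos[of \<delta>] by (intro mult_right_mono) auto
  ultimately show ?thesis by linarith
qed

text \<open>For one state and empty \<open>T\<close>, all of \<alpha>, \<open>\<alpha>0\<close>,
  \<open>\<epsilon>a\<close>, \<open>\<epsilon>s\<close> equal 1 and the mass is 0, so the strict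
  bounds of the first and third claims fail; hence their extra premise.\<close>

theorem theorem3:
  fixes \<delta> :: "('q::finite, 'a::finite) mdp"
    and T :: "'q set"
    and d0 :: "'q pmf"
    and n :: nat
    and \<alpha> \<alpha>0 \<epsilon>a \<epsilon>s :: real
  assumes n: "n = CARD('q)"
    and \<alpha>: "\<alpha> = min_trans_prob \<delta>"
    and \<alpha>0: "\<alpha>0 = min_init_prob d0"
    and \<epsilon>a: "\<epsilon>a = \<alpha>0 * (\<alpha> ^ n / real n)"
    and \<epsilon>s: "\<epsilon>s = \<alpha>0 * (\<alpha> ^ (2 * n) / real (n ^ 2))"
  shows
    "(\<not> (n = 1 \<and> T = {}) \<longrightarrow> \<not> sure_always_sync \<delta> d0 T \<longrightarrow>
        (\<forall>\<sigma>. \<exists>i\<le>n. mass (state_dist \<delta> \<sigma> d0 i) T < 1 - \<epsilon>a)) \<and>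
     (\<not> sure_strongly_sync \<delta> d0 T \<longrightarrow>
        (\<forall>\<sigma>. \<exists>i :: nat \<Rightarrow> nat. strict_mono i \<and> i 0 \<le> n \<and> (\<forall>j. i (Suc j) - i j \<le> n) \<and>
           (\<forall>j. mass (state_dist \<delta> \<sigma> d0 (i j)) T < 1))) \<and>
     (\<not> (n = 1 \<and> T = {}) \<longrightarrow> \<not> almost_sure_strongly_sync \<delta> d0 T \<longrightarrow>
        (\<forall>\<sigma>. \<exists>i :: nat \<Rightarrow> nat. strict_mono i \<and> i 0 \<le> n \<and> (\<forall>j. i (Suc j) - i j \<le> n) \<and>
           (\<forall>j. mass (state_dist \<delta> \<sigma> d0 (i j)) T < 1 - \<epsilon>s)))"
proof (intro conjI impI allI)
  have n_pos: "0 < n" by (simp add: n)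
  have \<alpha>_bounds: "0 < \<alpha>" "\<alpha> \<le> 1"
    unfolding \<alpha> by (rule min_trans_prob_pos min_trans_prob_le_1)+
  have \<alpha>0_pos: "0 < \<alpha>0" unfolding \<alpha>0 by (rule min_init_prob_pos)
  let ?p = "\<lambda>\<sigma> i. measure_pmf.prob (state_pmf \<delta> \<sigma> d0 i)"
  have compl: "?p \<sigma> i (- T) = 1 - ?p \<sigma> i T" for \<sigma> i
    using measure_pmf.prob_compl[of T "state_pmf \<delta> \<sigma> d0 i"] by (simp add: Compl_eq_Diff_UNIV)
  have sync_UNIV: "mass (state_dist \<delta> \<sigma> d0 i) UNIV = 1" for \<sigma> i
    by (simp add: mass_state_dist)
  have n_ge_2: "2 \<le> n" if "\<not> (n = 1 \<and> T = {})" "T \<noteq> UNIV"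
  proof (rule ccontr)
    assume "\<not> 2 \<le> n"
    then have "n = 1" using n_pos by linarith
    moreover have "card T < CARD('q)" using that(2) by (intro psubset_card_mono) auto
    ultimately show False using that(1) n by simp
  qed
  {
    fix \<sigma>
    assume nontriv: "\<not> (n = 1 \<and> T = {})" and not_sync: "\<not> sure_always_sync \<delta> d0 T"
    have "T \<noteq> UNIV" using not_sync sync_UNIV unfolding sure_always_sync_def by blast
    then obtain S where S: "S \<subseteq> T" "\<forall>q\<in>S. \<exists>a. set_pmf (\<delta> q a) \<subseteq> S"
      and sum: "\<forall>\<sigma> d0 m. min_trans_prob \<delta> ^ (CARD('q) - 1) * measure (state_pmf \<delta> \<sigma> d0 m) (- S) \<le>
        (\<Sum>i<CARD('q). measure (state_pmf \<delta> \<sigma> d0 (m + i)) (- T))"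
      by (rule safe_window[where \<delta> = \<delta>])
    \<comment> \<open>With position 0 set apart, only \<open>k = n - 1\<close> terms are averaged;
      the ratio \<open>k / n\<close> makes the bound strict even when \<alpha> is 1.\<close>
    obtain k where k: "n = Suc k" "0 < k"
      using n_ge_2[OF nontriv \<open>T \<noteq> UNIV\<close>] by (cases n) auto
    have \<epsilon>_less: "real k * \<epsilon>a < \<alpha>0 * \<alpha> ^ k"
    proof -
      have "real k * \<epsilon>a = (real k / real n * \<alpha>) * (\<alpha>0 * \<alpha> ^ k)" by (simp add: \<epsilon>a k)
      also have "\<dots> < 1 * (\<alpha>0 * \<alpha> ^ k)"
      proof (rule mult_strict_right_mono)
        have "real k / real n * \<alpha> \<le> real k / real n" using \<alpha>_bounds by (intro mult_left_le) auto
        also have "\<dots> < 1" by (simp add: k)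
        finally show "real k / real n * \<alpha> < 1" .
      qed (use \<alpha>0_pos \<alpha>_bounds in simp)
      finally show ?thesis by simp
    qed
    have "\<not> set_pmf (state_pmf \<delta> \<sigma> d0 0) \<subseteq> S"
      using not_sync safe_strategy[OF S(2,1), of \<sigma> d0 0] unfolding sure_always_sync_def by auto
    then have "\<alpha>0 \<le> ?p \<sigma> 0 (- S)"
      unfolding \<alpha>0 state_pmf_0 by (intro min_init_prob_le_measure) auto
    then have "\<alpha>0 * \<alpha> ^ k \<le> \<alpha> ^ k * ?p \<sigma> 0 (- S)"
      using \<alpha>_bounds by (simp add: mult.commute)
    also have "\<dots> \<le> (\<Sum>i<n. ?p \<sigma> i (- T))" using sum[rule_format, of \<sigma> d0 0] by (simp add: n \<alpha> k flip: n)
    finally have ge: "\<alpha>0 * \<alpha> ^ k \<le> ?p \<sigma> 0 (- T) + (\<Sum>i<k. ?p \<sigma> (Suc i) (- T))"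
      unfolding k by (simp only: sum.lessThan_Suc_shift)
    \<comment> \<open>Either \<open>d0\<close> lies in \<open>T\<close> and the later positions
      carry the whole sum, or position 0 alone already has mass \<open>\<alpha>0\<close> outside
      \<open>T\<close>.\<close>
    have "\<exists>i\<le>n. \<epsilon>a < ?p \<sigma> i (- T)"
    proof (cases "set_pmf d0 \<inter> - T = {}")
      case True
      then have "?p \<sigma> 0 (- T) = 0" by (simp add: state_pmf_0 measure_pmf_zero_iff)
      then have "real k * \<epsilon>a < (\<Sum>i<k. ?p \<sigma> (Suc i) (- T))" using \<epsilon>_less ge by linarith
      then obtain i where "i < k" "\<epsilon>a < ?p \<sigma> (Suc i) (- T)" using exists_gt_of_sum by blast
      then show ?thesis using k by (intro exI[of _ "Suc i"]) simp
    next
      case False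
      then have "\<alpha>0 \<le> ?p \<sigma> 0 (- T)"
        unfolding \<alpha>0 state_pmf_0 by (rule min_init_prob_le_measure)
      moreover have "1 * \<epsilon>a \<le> real k * \<epsilon>a"
        using k \<alpha>0_pos \<alpha>_bounds by (intro mult_right_mono) (auto simp: \<epsilon>a)
      moreover have "\<alpha>0 * \<alpha> ^ k \<le> \<alpha>0"
        using \<alpha>0_pos \<alpha>_bounds by (simp add: mult_left_le power_le_one)
      ultimately have "\<epsilon>a < ?p \<sigma> 0 (- T)" using \<epsilon>_less by linarith
      then show ?thesis by blast
    qed
    then show "\<exists>i\<le>n. mass (state_dist \<delta> \<sigma> d0 i) T < 1 - \<epsilon>a"
      unfolding mass_state_dist compl by (simp add: algebra_simps)
  next
    fix \<sigma>
    assume not_sync: "\<not> sure_strongly_sync \<delta> d0 T"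
    have "T \<noteq> UNIV" using not_sync sync_UNIV unfolding sure_strongly_sync_def by blast
    then obtain S where S: "S \<subseteq> T" "\<forall>q\<in>S. \<exists>a. set_pmf (\<delta> q a) \<subseteq> S"
      and sum: "\<forall>\<sigma> d0 m. min_trans_prob \<delta> ^ (CARD('q) - 1) * measure (state_pmf \<delta> \<sigma> d0 m) (- S) \<le>
        (\<Sum>i<CARD('q). measure (state_pmf \<delta> \<sigma> d0 (m + i)) (- T))"
      by (rule safe_window[where \<delta> = \<delta>])
    have "\<exists>i. m \<le> i \<and> i < m + n \<and> mass (state_dist \<delta> \<sigma> d0 i) T < 1" for m
    proof -
      \<comment> \<open>Otherwise switching at \<open>m\<close> to a strategy that stays in
        \<open>S\<close> would synchronize surely from \<open>m\<close> on.\<close>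
      have "\<not> set_pmf (state_pmf \<delta> \<sigma> d0 m) \<subseteq> S"
        using not_sync safe_strategy[OF S(2,1), of \<sigma> d0 m] unfolding sure_strongly_sync_def by blast
      then have "0 < ?p \<sigma> m (- S)" by (auto simp: measure_pmf_pos_iff)
      then have "0 < \<alpha> ^ (n - 1) * ?p \<sigma> m (- S)" using \<alpha>_bounds by simp
      also have "\<dots> \<le> (\<Sum>i<n. ?p \<sigma> (m + i) (- T))" using sum[rule_format, of \<sigma> d0 m] by (simp add: n \<alpha>)
      finally have "real n * 0 < (\<Sum>i<n. ?p \<sigma> (m + i) (- T))" by simp
      then obtain i where "i < n" "0 < ?p \<sigma> (m + i) (- T)" using exists_gt_of_sum by blast
      then show ?thesis
        by (intro exI[of _ "m + i"]) (simp add: mass_state_dist compl)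
    qed
    then show "\<exists>i :: nat \<Rightarrow> nat. strict_mono i \<and> i 0 \<le> n \<and> (\<forall>j. i (Suc j) - i j \<le> n) \<and>
        (\<forall>j. mass (state_dist \<delta> \<sigma> d0 (i j)) T < 1)"
      by (rule frequent_positions)
  next
    fix \<sigma>
    assume nontriv: "\<not> (n = 1 \<and> T = {})" and not_sync: "\<not> almost_sure_strongly_sync \<delta> d0 T"
    have "T \<noteq> UNIV"
    proof
      assume "T = UNIV"
      then have "almost_sure_strongly_sync \<delta> d0 T"
        by (simp add: almost_sure_strongly_sync_def sync_UNIV)
      then show False using not_sync by contradiction
    qed
    then obtain S where S: "S \<subseteq> T" "\<forall>q\<in>S. \<exists>a. set_pmf (\<delta> q a) \<subseteq> S"
      and sum: "\<forall>\<sigma> d0 m. min_trans_prob \<delta> ^ (CARD('q) - 1) * measure (state_pmf \<delta> \<sigma> d0 m) (- S) \<le>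
        (\<Sum>i<CARD('q). measure (state_pmf \<delta> \<sigma> d0 (m + i)) (- T))"
      by (rule safe_window[where \<delta> = \<delta>])
    have n2: "2 \<le> n" by (rule n_ge_2[OF nontriv \<open>T \<noteq> UNIV\<close>])
    have "\<exists>i. m \<le> i \<and> i < m + n \<and> mass (state_dist \<delta> \<sigma> d0 i) T < 1 - \<epsilon>s" for m
    proof -
      \<comment> \<open>One power \<open>\<alpha> ^ (n - 1)\<close> bounds the mass outside
        \<open>S\<close>, the other the chance of then leaving \<open>T\<close>. Strictness comes
        from dividing by \<open>n\<close>, which is at least 2.\<close>
      have "real n * \<epsilon>s = \<alpha>0 * \<alpha> ^ (2 * n) / real n"
        using n_pos by (simp add: \<epsilon>s power2_eq_square)
      also have "\<dots> < \<alpha>0 * \<alpha> ^ (2 * n)"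
        using n2 \<alpha>0_pos \<alpha>_bounds by (simp add: divide_less_eq)
      also have "\<dots> \<le> \<alpha>0 * \<alpha> ^ ((n - 1) + (n - 1))"
        using \<alpha>0_pos \<alpha>_bounds by (intro mult_left_mono power_decreasing) auto
      also have "\<dots> = \<alpha> ^ (n - 1) * (\<alpha>0 * \<alpha> ^ (n - 1))" by (simp add: power_add)
      also have "\<dots> \<le> \<alpha> ^ (n - 1) * ?p \<sigma> m (- S)"
        using \<alpha>_bounds not_reach_lower_bound[OF S(2,1) not_sync]
        by (intro mult_left_mono) (auto simp: n \<alpha> \<alpha>0)
      also have "\<dots> \<le> (\<Sum>i<n. ?p \<sigma> (m + i) (- T))" using sum[rule_format, of \<sigma> d0 m] by (simp add: n \<alpha>)
      finally obtain i where "i < n" "\<epsilon>s < ?p \<sigma> (m + i) (- T)" using exists_gt_of_sum by blast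
      then show ?thesis
        by (intro exI[of _ "m + i"]) (simp add: mass_state_dist compl)
    qed
    then show "\<exists>i :: nat \<Rightarrow> nat. strict_mono i \<and> i 0 \<le> n \<and> (\<forall>j. i (Suc j) - i j \<le> n) \<and>
        (\<forall>j. mass (state_dist \<delta> \<sigma> d0 (i j)) T < 1 - \<epsilon>s)"
      by (rule frequent_positions)
  }
qed

end
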